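(* Let $W\in L^1((0,1)^2)$ be a graphon with $W(x,y)=W(y,x)\ge0$ for all $(x,y)\in(0,1)^2$ and $\int_0^1W(x,y)\,dy\le1$ for a.e. $x\in(0,1)$. Let $\Phi:\mathbb{R}\to\mathbb{R}$ satisfy $\Phi(0)=0$ and be locally Lipschitz continuous (Lipschitz on every bounded subset of $\mathbb{R}$). Let $u_0\in L^\infty((0,1))$ with $\|u_0\|_\infty\le M$ for some constant $M>0$. Then there exists $T_{max}\in(0,\infty]$ (depending on $M$ and on the Lipschitz constant of $\Phi$ on $[-M,M]$) such that the graphon reaction--diffusion equation $$\partial_tu=\mathcal{L}^Wu+\Phi(u)$$ with initial condition $u(x,0)=u_0(x)$ has a unique classical solution $u\in C^1([0,T_{max});L^\infty((0,1)))$, which satisfies the mild formulation $$u(\cdot,t)=e^{t\mathcal{L}^W}u_0+\int_0^te^{(t-s)\mathcal{L}^W}\Phi(u(\cdot,s))\,ds.$$ Moreover, if $T_{max}<\infty$, then $\lim_{t\to T_{max}}\|u(\cdot,t)\|_\infty=+\infty$.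
   Context: The graphon diffusion operator is $\mathcal{L}^W u(x)=\int_0^1 W(x,y)\,(u(y)-u(x))\,dy$; under the stated hypotheses on $W$ it is a bounded linear operator on $L^\infty((0,1))$, and $\{e^{t\mathcal{L}^W}\}_{t\ge0}$ denotes the uniformly continuous semigroup it generates. $\Phi(u)$ denotes the pointwise composition $x\mapsto\Phi(u(x,t))$. A classical solution is one for which the equation holds as an identity in $L^\infty((0,1))$ at each time of the interval of existence.
   Formalization: T_max may depend on W, Φ and u_0, not only on M and the Lipschitz constant of Φ on [-M,M]; sole dependence on those is false: for W=0, Φ(u)=u², M=1, u_0=0 gives a global bounded solution while u_0=1 blows up at t=1. *)

theory Defs
  imports "HOL-Analysis.Analysis" "HOL-Probability.Essential_Supremum"
begin

unbundle lipschitz_syntax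

section \<open>The Banach space \<open>L\<^sup>\<infinity>((0,1))\<close>\<close>

abbreviation unit_interval :: "real measure"
  where "unit_interval \<equiv> lebesgue_on {0<..<1}"

definition ess_bounded :: "(real \<Rightarrow> real) set"
  where "ess_bounded = {f \<in> borel_measurable unit_interval. \<exists>C. AE x in unit_interval. \<bar>f x\<bar> \<le> C}"

definition Linf_norm :: "(real \<Rightarrow> real) \<Rightarrow> real"
  where "Linf_norm f = real_of_ereal (esssup unit_interval (\<lambda>x. ereal \<bar>f x\<bar>))"

lemma ess_bounded_measurable [dest]: "f \<in> ess_bounded \<Longrightarrow> f \<in> borel_measurable unit_interval"
  by (simp add: ess_bounded_def)

lemma ess_boundedI:
  "f \<in> borel_measurable unit_interval \<Longrightarrow> AE x in unit_interval. \<bar>f x\<bar> \<le> C \<Longrightarrow> f \<in> ess_bounded"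
  by (auto simp: ess_bounded_def)

lemma emeasure_unit_interval: "emeasure unit_interval (space unit_interval) = 1"
  by (simp add: emeasure_restrict_space)

lemma AE_unit_interval_const: "(AE x in unit_interval. P) \<longleftrightarrow> P"
proof -
  have "ae_filter unit_interval \<noteq> bot"
    using emeasure_unit_interval by (simp add: ae_filter_eq_bot_iff)
  then show ?thesis by (rule eventually_const)
qed

lemma AE_Linf_norm:
  assumes "f \<in> ess_bounded"
  shows "AE x in unit_interval. \<bar>f x\<bar> \<le> Linf_norm f"
    and "0 \<le> Linf_norm f"
    and "AE x in unit_interval. \<bar>f x\<bar> \<le> c \<Longrightarrow> Linf_norm f \<le> c"
proof -
  let ?E = "esssup unit_interval (\<lambda>x. ereal \<bar>f x\<bar>)"
  have m [measurable]: "f \<in> borel_measurable unit_interval"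
    using assms by blast
  have le: "?E \<le> ereal C" if "AE x in unit_interval. \<bar>f x\<bar> \<le> C" for C
    using that by (intro esssup_I) auto
  obtain C where "AE x in unit_interval. \<bar>f x\<bar> \<le> C"
    using assms by (auto simp: ess_bounded_def)
  then have fin1: "?E \<le> ereal C" by (rule le)
  have ae: "AE x in unit_interval. ereal \<bar>f x\<bar> \<le> ?E"
    by (rule esssup_AE)
  then have "AE x in unit_interval. 0 \<le> ?E"
  proof eventually_elim
    case (elim x)
    have "0 \<le> ereal \<bar>f x\<bar>" by simp
    then show ?case using elim by (rule order_trans)
  qed
  then have nn: "0 \<le> ?E"
    by (simp only: AE_unit_interval_const)
  then have eq: "?E = ereal (Linf_norm f)"
    using fin1 by (cases ?E) (auto simp: Linf_norm_def)
  show "AE x in unit_interval. \<bar>f x\<bar> \<le> Linf_norm f"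
    using ae by (simp add: eq)
  show "0 \<le> Linf_norm f"
    using nn by (simp add: eq)
  show "Linf_norm f \<le> c" if "AE x in unit_interval. \<bar>f x\<bar> \<le> c"
    using le[OF that] by (simp add: eq)
qed

lemma ess_bounded_zero: "(\<lambda>x. 0) \<in> ess_bounded"
  by (rule ess_boundedI[where C = 0]) auto

lemma ess_bounded_add:
  assumes "f \<in> ess_bounded" "g \<in> ess_bounded"
  shows "(\<lambda>x. f x + g x) \<in> ess_bounded"
proof (rule ess_boundedI)
  show "(\<lambda>x. f x + g x) \<in> borel_measurable unit_interval"
    using assms by (auto intro!: borel_measurable_add)
  show "AE x in unit_interval. \<bar>f x + g x\<bar> \<le> Linf_norm f + Linf_norm g"
    using AE_Linf_norm(1)[OF assms(1)] AE_Linf_norm(1)[OF assms(2)] by eventually_elim auto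
qed

lemma ess_bounded_scale:
  assumes "f \<in> ess_bounded"
  shows "(\<lambda>x. c * f x) \<in> ess_bounded"
proof (rule ess_boundedI)
  show "(\<lambda>x. c * f x) \<in> borel_measurable unit_interval"
    using assms by (auto intro!: borel_measurable_times)
  show "AE x in unit_interval. \<bar>c * f x\<bar> \<le> \<bar>c\<bar> * Linf_norm f"
    using AE_Linf_norm(1)[OF assms]
    by eventually_elim (auto simp: abs_mult intro: mult_left_mono)
qed

lemma ess_bounded_uminus: "f \<in> ess_bounded \<Longrightarrow> (\<lambda>x. - f x) \<in> ess_bounded"
  using ess_bounded_scale[of f "-1"] by simp

lemma ess_bounded_diff:
  "f \<in> ess_bounded \<Longrightarrow> g \<in> ess_bounded \<Longrightarrow> (\<lambda>x. f x - g x) \<in> ess_bounded"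
  using ess_bounded_add[of f "\<lambda>x. - g x"] ess_bounded_uminus[of g] by simp

lemma Linf_norm_cong:
  assumes "f \<in> ess_bounded" "g \<in> ess_bounded" "AE x in unit_interval. f x = g x"
  shows "Linf_norm f = Linf_norm g"
proof (rule antisym)
  show "Linf_norm f \<le> Linf_norm g"
    by (rule AE_Linf_norm(3)[OF assms(1)])
      (use assms(3) AE_Linf_norm(1)[OF assms(2)] in \<open>eventually_elim, simp\<close>)
  show "Linf_norm g \<le> Linf_norm f"
    by (rule AE_Linf_norm(3)[OF assms(2)])
      (use assms(3) AE_Linf_norm(1)[OF assms(1)] in \<open>eventually_elim, simp\<close>)
qed

definition Linf_rel :: "(real \<Rightarrow> real) \<Rightarrow> (real \<Rightarrow> real) \<Rightarrow> bool"
  where "Linf_rel f g \<longleftrightarrow> f \<in> ess_bounded \<and> g \<in> ess_bounded \<and> (AE x in unit_interval. f x = g x)"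

quotient_type Linf = "real \<Rightarrow> real" / partial: Linf_rel
proof (rule part_equivpI)
  show "\<exists>f. Linf_rel f f"
    using ess_bounded_zero by (auto simp: Linf_rel_def)
  show "symp Linf_rel"
    by (auto simp: symp_def Linf_rel_def)
  show "transp Linf_rel"
    by (auto simp: transp_def Linf_rel_def)
qed

instantiation Linf :: real_normed_vector
begin

lift_definition zero_Linf :: Linf is "\<lambda>x. 0"
  by (simp add: Linf_rel_def ess_bounded_zero)

lift_definition plus_Linf :: "Linf \<Rightarrow> Linf \<Rightarrow> Linf" is "\<lambda>f g x. f x + g x"
  by (auto simp: Linf_rel_def intro: ess_bounded_add)

lift_definition uminus_Linf :: "Linf \<Rightarrow> Linf" is "\<lambda>f x. - f x"
  by (auto simp: Linf_rel_def intro: ess_bounded_uminus)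

lift_definition minus_Linf :: "Linf \<Rightarrow> Linf \<Rightarrow> Linf" is "\<lambda>f g x. f x - g x"
  by (auto simp: Linf_rel_def intro: ess_bounded_diff)

lift_definition scaleR_Linf :: "real \<Rightarrow> Linf \<Rightarrow> Linf" is "\<lambda>c f x. c * f x"
  by (auto simp: Linf_rel_def intro: ess_bounded_scale)

lift_definition norm_Linf :: "Linf \<Rightarrow> real" is Linf_norm
  by (auto simp: Linf_rel_def intro: Linf_norm_cong)

definition dist_Linf :: "Linf \<Rightarrow> Linf \<Rightarrow> real"
  where "dist_Linf u v = norm (u - v)"

definition sgn_Linf :: "Linf \<Rightarrow> Linf"
  where "sgn_Linf u = inverse (norm u) *\<^sub>R u"

definition uniformity_Linf :: "(Linf \<times> Linf) filter"
  where "uniformity_Linf = (INF e\<in>{0<..}. principal {(u, v). dist u v < e})"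

definition open_Linf :: "Linf set \<Rightarrow> bool"
  where "open_Linf U \<longleftrightarrow> (\<forall>u\<in>U. \<forall>\<^sub>F (u', v) in uniformity. u' = u \<longrightarrow> v \<in> U)"

instance
proof
  fix u v w :: Linf and a b :: real
  show "u + v + w = u + (v + w)" "u + v = v + u" "0 + u = u" "- u + u = 0" "u - v = u + - v"
    by (transfer, auto simp: Linf_rel_def algebra_simps
        intro: ess_bounded_add ess_bounded_diff ess_bounded_zero)+
  show "a *\<^sub>R (u + v) = a *\<^sub>R u + a *\<^sub>R v" "(a + b) *\<^sub>R u = a *\<^sub>R u + b *\<^sub>R u"
    "a *\<^sub>R b *\<^sub>R u = (a * b) *\<^sub>R u" "1 *\<^sub>R u = u"
    by (transfer, auto simp: Linf_rel_def algebra_simps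
        intro: ess_bounded_add ess_bounded_scale ess_bounded_scale[of _ "a * b" for a b, simplified mult.assoc])+
  show "dist u v = norm (u - v)" by (rule dist_Linf_def)
  show "sgn u = inverse (norm u) *\<^sub>R u" by (rule sgn_Linf_def)
  show "uniformity = (INF e\<in>{0<..}. principal {(u::Linf, v). dist u v < e})"
    by (rule uniformity_Linf_def)
  show "open U \<longleftrightarrow> (\<forall>u\<in>U. \<forall>\<^sub>F (u', v) in uniformity. u' = u \<longrightarrow> v \<in> U)" for U :: "Linf set"
    by (rule open_Linf_def)
  show "norm u = 0 \<longleftrightarrow> u = 0"
  proof transfer
    fix f assume "Linf_rel f f"
    then have f: "f \<in> ess_bounded" by (simp add: Linf_rel_def)
    show "Linf_norm f = 0 \<longleftrightarrow> Linf_rel f (\<lambda>x. 0)"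
    proof
      assume "Linf_norm f = 0"
      then show "Linf_rel f (\<lambda>x. 0)"
        using AE_Linf_norm(1)[OF f] by (simp add: Linf_rel_def f ess_bounded_zero)
    next
      assume "Linf_rel f (\<lambda>x. 0)"
      then have "AE x in unit_interval. \<bar>f x\<bar> \<le> 0" by (simp add: Linf_rel_def)
      then show "Linf_norm f = 0"
        using AE_Linf_norm(2,3)[OF f] by (meson antisym)
    qed
  qed
  show "norm (u + v) \<le> norm u + norm v"
  proof transfer
    fix f g assume "Linf_rel f f" "Linf_rel g g"
    then have f: "f \<in> ess_bounded" and g: "g \<in> ess_bounded" by (simp_all add: Linf_rel_def)
    show "Linf_norm (\<lambda>x. f x + g x) \<le> Linf_norm f + Linf_norm g"
      by (rule AE_Linf_norm(3)[OF ess_bounded_add[OF f g]])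
        (use AE_Linf_norm(1)[OF f] AE_Linf_norm(1)[OF g] in \<open>eventually_elim, simp\<close>)
  qed
  show "norm (a *\<^sub>R u) = \<bar>a\<bar> * norm u"
  proof transfer
    fix a :: real and f assume "Linf_rel f f"
    then have f: "f \<in> ess_bounded" by (simp add: Linf_rel_def)
    note af = ess_bounded_scale[OF f, of a]
    have le: "Linf_norm (\<lambda>x. a * f x) \<le> \<bar>a\<bar> * Linf_norm f"
      by (rule AE_Linf_norm(3)[OF af])
        (use AE_Linf_norm(1)[OF f] in \<open>eventually_elim, auto simp: abs_mult intro: mult_left_mono\<close>)
    show "Linf_norm (\<lambda>x. a * f x) = \<bar>a\<bar> * Linf_norm f"
    proof (cases "a = 0")
      case True
      then show ?thesis using le AE_Linf_norm(2)[OF af] by simp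
    next
      case False
      have "AE x in unit_interval. \<bar>f x\<bar> \<le> Linf_norm (\<lambda>x. a * f x) / \<bar>a\<bar>"
        using AE_Linf_norm(1)[OF af] by eventually_elim (use False in \<open>simp add: abs_mult field_simps\<close>)
      then have "Linf_norm f \<le> Linf_norm (\<lambda>x. a * f x) / \<bar>a\<bar>"
        by (rule AE_Linf_norm(3)[OF f])
      then show ?thesis using le False by (simp add: field_simps)
    qed
  qed
qed

end

text \<open>\<open>rep_Linf u\<close> is a representative of the class \<open>u\<close>; conversely \<open>to_Linf f\<close> is the class of
  \<open>f\<close>, with the dummy value \<open>0\<close> if \<open>f\<close> is not measurable and essentially bounded.\<close>

definition to_Linf :: "(real \<Rightarrow> real) \<Rightarrow> Linf"
  where "to_Linf f = (if f \<in> ess_bounded then abs_Linf f else 0)"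

lemma rep_Linf_ess_bounded [simp]: "rep_Linf u \<in> ess_bounded"
  using Quotient3_rep_reflp[OF Quotient3_Linf, of u] by (simp add: Linf_rel_def)

lemma to_Linf_rep_Linf [simp]: "to_Linf (rep_Linf u) = u"
  by (simp add: to_Linf_def Quotient3_abs_rep[OF Quotient3_Linf])

lemma to_Linf_eq_iff:
  "f \<in> ess_bounded \<Longrightarrow> g \<in> ess_bounded \<Longrightarrow>
    to_Linf f = to_Linf g \<longleftrightarrow> (AE x in unit_interval. f x = g x)"
  using Quotient3_rel[OF Quotient3_Linf, of f g] by (auto simp: to_Linf_def Linf_rel_def)

lemma AE_rep_to_Linf:
  "f \<in> ess_bounded \<Longrightarrow> AE x in unit_interval. rep_Linf (to_Linf f) x = f x"
  by (subst to_Linf_eq_iff[symmetric]) auto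

lemma norm_to_Linf: "f \<in> ess_bounded \<Longrightarrow> norm (to_Linf f) = Linf_norm f"
  by (simp add: to_Linf_def norm_Linf.abs_eq Linf_rel_def)

lemma norm_Linf_eq: "norm u = Linf_norm (rep_Linf u)"
  by (metis norm_to_Linf rep_Linf_ess_bounded to_Linf_rep_Linf)

lemma to_Linf_add:
  "f \<in> ess_bounded \<Longrightarrow> g \<in> ess_bounded \<Longrightarrow> to_Linf (\<lambda>x. f x + g x) = to_Linf f + to_Linf g"
  by (simp add: to_Linf_def ess_bounded_add plus_Linf.abs_eq Linf_rel_def)

lemma to_Linf_diff:
  "f \<in> ess_bounded \<Longrightarrow> g \<in> ess_bounded \<Longrightarrow> to_Linf (\<lambda>x. f x - g x) = to_Linf f - to_Linf g"
  by (simp add: to_Linf_def ess_bounded_diff minus_Linf.abs_eq Linf_rel_def)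

lemma to_Linf_scaleR:
  "f \<in> ess_bounded \<Longrightarrow> to_Linf (\<lambda>x. c * f x) = c *\<^sub>R to_Linf f"
  by (simp add: to_Linf_def ess_bounded_scale scaleR_Linf.abs_eq Linf_rel_def)

lemma AE_abs_diff_le_norm: "AE x in unit_interval. \<bar>rep_Linf u x - rep_Linf v x\<bar> \<le> norm (u - v)"
proof -
  have "u - v = to_Linf (\<lambda>x. rep_Linf u x - rep_Linf v x)"
    by (simp add: to_Linf_diff)
  then show ?thesis
    using AE_Linf_norm(1)[OF ess_bounded_diff[of "rep_Linf u" "rep_Linf v"]]
    by (simp add: norm_to_Linf ess_bounded_diff)
qed

instance Linf :: banach
proof
  fix X :: "nat \<Rightarrow> Linf"
  assume X: "Cauchy X"
  let ?f = "\<lambda>n. rep_Linf (X n)"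
  define g where "g = (\<lambda>x. lim (\<lambda>n. ?f n x))"
  have m [measurable]: "?f n \<in> borel_measurable unit_interval" for n
    by (rule ess_bounded_measurable) simp
  have "AE x in unit_interval. \<forall>m n. \<bar>?f m x - ?f n x\<bar> \<le> norm (X m - X n)"
    by (simp add: AE_all_countable AE_abs_diff_le_norm)
  then have lim: "AE x in unit_interval. (\<forall>m n. \<bar>?f m x - ?f n x\<bar> \<le> norm (X m - X n)) \<and> (\<lambda>n. ?f n x) \<longlonglongrightarrow> g x"
  proof eventually_elim
    case (elim x)
    have "Cauchy (\<lambda>n. ?f n x)"
    proof (rule metric_CauchyI)
      fix e :: real assume "0 < e"
      then obtain N where "\<And>m n. m \<ge> N \<Longrightarrow> n \<ge> N \<Longrightarrow> dist (X m) (X n) < e"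
        using metric_CauchyD[OF X] by blast
      then show "\<exists>N. \<forall>m\<ge>N. \<forall>n\<ge>N. dist (?f m x) (?f n x) < e"
        using elim by (metis dist_norm le_less_trans real_norm_def)
    qed
    then show ?case
      using elim by (auto simp: g_def Cauchy_convergent_iff convergent_LIMSEQ_iff)
  qed
  have gm [measurable]: "g \<in> borel_measurable unit_interval"
    unfolding g_def by measurable
  have close: "AE x in unit_interval. \<bar>?f m x - g x\<bar> \<le> e"
    if N: "\<And>n. n \<ge> N \<Longrightarrow> norm (X m - X n) \<le> e" for m N e
    using lim
  proof eventually_elim
    case (elim x)
    have "(\<lambda>n. \<bar>?f m x - ?f n x\<bar>) \<longlonglongrightarrow> \<bar>?f m x - g x\<bar>"
      using elim by (intro tendsto_intros) auto
    moreover have "\<forall>\<^sub>F n in sequentially. \<bar>?f m x - ?f n x\<bar> \<le> e"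
      using elim N by (intro eventually_sequentiallyI[of N]) (meson order_trans)
    ultimately show ?case
      by (rule tendsto_upperbound) simp
  qed
  have cauchy: "\<exists>N. \<forall>m\<ge>N. \<forall>n\<ge>N. norm (X m - X n) \<le> e" if "e > 0" for e
    using metric_CauchyD[OF X that] by (metis dist_norm less_imp_le)
  have g: "g \<in> ess_bounded"
  proof -
    obtain N where "\<forall>m\<ge>N. \<forall>n\<ge>N. norm (X m - X n) \<le> 1"
      using cauchy[of 1] by auto
    then have "AE x in unit_interval. \<bar>?f N x - g x\<bar> \<le> 1"
      by (intro close[of N]) auto
    with AE_Linf_norm(1)[OF rep_Linf_ess_bounded[of "X N"]]
    have "AE x in unit_interval. \<bar>g x\<bar> \<le> Linf_norm (?f N) + 1"
      by eventually_elim auto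
    then show ?thesis
      by (rule ess_boundedI[OF gm])
  qed
  have "X \<longlonglongrightarrow> to_Linf g"
  proof (rule metric_LIMSEQ_I)
    fix e :: real assume "0 < e"
    then obtain N where N: "\<forall>m\<ge>N. \<forall>n\<ge>N. norm (X m - X n) \<le> e / 2"
      using cauchy[of "e/2"] by auto
    have "dist (X m) (to_Linf g) < e" if "m \<ge> N" for m
    proof -
      have "AE x in unit_interval. \<bar>?f m x - g x\<bar> \<le> e / 2"
        using N that by (intro close[of N]) auto
      then have "Linf_norm (\<lambda>x. ?f m x - g x) \<le> e / 2"
        by (rule AE_Linf_norm(3)[OF ess_bounded_diff[OF rep_Linf_ess_bounded g]])
      moreover have "X m - to_Linf g = to_Linf (\<lambda>x. ?f m x - g x)"
        using to_Linf_diff[OF rep_Linf_ess_bounded g, of "X m"] by simp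
      ultimately show ?thesis
        using \<open>0 < e\<close> by (simp add: dist_norm norm_to_Linf ess_bounded_diff g)
    qed
    then show "\<exists>N. \<forall>m\<ge>N. dist (X m) (to_Linf g) < e" by blast
  qed
  then show "convergent X" by (rule convergentI)
qed

section \<open>The graphon diffusion operator\<close>

definition graphon_laplacian :: "(real \<Rightarrow> real \<Rightarrow> real) \<Rightarrow> (real \<Rightarrow> real) \<Rightarrow> real \<Rightarrow> real"
  where "graphon_laplacian W f x = (\<integral>y. W x y * (f y - f x) \<partial>unit_interval)"

definition admissible_graphon :: "(real \<Rightarrow> real \<Rightarrow> real) \<Rightarrow> bool"
  where "admissible_graphon W \<longleftrightarrow>
    integrable (lebesgue_on ({0<..<1} \<times> {0<..<1})) (\<lambda>(x, y). W x y) \<and>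
    (\<forall>x\<in>{0<..<1}. \<forall>y\<in>{0<..<1}. W x y = W y x \<and> 0 \<le> W x y) \<and>
    (AE x in unit_interval. (\<integral>y. W x y \<partial>unit_interval) \<le> 1)"

text \<open>\<open>Blinfun\<close> is meaningful only on bounded linear maps; \<open>graphon_operator_apply\<close> below shows
  that this is the case for every admissible graphon.\<close>

definition graphon_operator :: "(real \<Rightarrow> real \<Rightarrow> real) \<Rightarrow> Linf \<Rightarrow>\<^sub>L Linf"
  where "graphon_operator W = Blinfun (\<lambda>u. to_Linf (graphon_laplacian W (rep_Linf u)))"

lemma unit_interval_AE_measurable:
  fixes f g :: "real \<Rightarrow> real"
  assumes f: "f \<in> borel_measurable unit_interval" and ae: "AE x in unit_interval. f x = g x"
  shows "g \<in> borel_measurable unit_interval"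
proof -
  have "(\<lambda>x. if x \<in> {0<..<1} then f x else 0) \<in> borel_measurable lebesgue"
    using f by (subst borel_measurable_if) auto
  moreover have "AE x in lebesgue. (if x \<in> {0<..<1} then f x else 0) = (if x \<in> {0<..<1} then g x else 0)"
    using ae by (subst (asm) AE_restrict_space_iff) (auto elim!: eventually_mono)
  ultimately have "(\<lambda>x. if x \<in> {0<..<1} then g x else 0) \<in> borel_measurable lebesgue"
    by (rule borel_measurable_AE)
  then show ?thesis
    by (subst (asm) borel_measurable_if) auto
qed

lemma unit_interval_integrable:
  fixes f :: "real \<Rightarrow> real"
  assumes "integrable lebesgue f"
  shows "integrable unit_interval f"
proof -
  have "integrable lebesgue (\<lambda>x. indicator {0<..<1} x *\<^sub>R f x)"
    using assms by (intro integrable_mult_indicator) auto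
  then show ?thesis
    by (simp add: integrable_restrict_space)
qed

lemma unit_interval_section:
  fixes W :: "real \<Rightarrow> real \<Rightarrow> real"
  assumes W: "integrable (lebesgue_on ({0<..<1} \<times> {0<..<1})) (\<lambda>(x, y). W x y)"
  shows "AE x in unit_interval. integrable unit_interval (W x)"
    and "f \<in> borel_measurable unit_interval \<Longrightarrow>
      (\<lambda>x. \<integral>y. W x y * f y \<partial>unit_interval) \<in> borel_measurable unit_interval"
proof -
  let ?I = "{0<..<1::real}"
  define W' where "W' = (\<lambda>z. if z \<in> ?I \<times> ?I then (case z of (x, y) \<Rightarrow> W x y) else 0)"
  have leb: "?I \<times> ?I \<in> sets lebesgue"
    by (intro sets_completionI_sets) (simp add: borel_open open_Times)
  have W': "integrable lebesgue W'"
    unfolding W'_def using W by (subst Lebesgue_Measure.integrable_restrict_UNIV[OF leb])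
  then obtain V where V [measurable]: "V \<in> borel_measurable lborel" and VW: "AE z in lborel. W' z = V z"
    using completion_ex_borel_measurable_real[of W' lborel] by (auto dest: borel_measurable_integrable)
  have "integrable lebesgue V"
    using W' VW by (subst integrable_cong_AE[of V _ W'])
      (auto intro: AE_completion measurable_completion elim!: eventually_mono)
  then have "integrable (lborel \<Otimes>\<^sub>M lborel) V"
    by (simp add: integrable_completion lborel_prod)
  then have V1: "AE x in lborel. integrable lborel (\<lambda>y. V (x, y))"
    by (rule lborel_pair.AE_integrable_fst')
  have V2: "AE x in lborel. AE y in lborel. W' (x, y) = V (x, y)"
    by (rule lborel_pair.AE_pair) (unfold lborel_prod, rule VW)
  have *: "AE x in unit_interval. (AE y in unit_interval. W x y = V (x, y)) \<and> integrable unit_interval (\<lambda>y. V (x, y))"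
  proof -
    have "AE x in lborel. x \<in> ?I \<longrightarrow> (AE y in unit_interval. W x y = V (x, y)) \<and> integrable unit_interval (\<lambda>y. V (x, y))"
      using V1 V2
    proof eventually_elim
      case (elim x)
      show ?case
      proof safe
        assume x: "x \<in> ?I"
        have "AE y in lebesgue. y \<in> ?I \<longrightarrow> W x y = V (x, y)"
          using AE_completion[OF elim(2)] by eventually_elim (use x in \<open>auto simp: W'_def\<close>)
        then show "AE y in unit_interval. W x y = V (x, y)"
          by (simp add: AE_restrict_space_iff)
        have "integrable lebesgue (\<lambda>y. V (x, y))"
          using elim(1) by (simp add: integrable_completion)
        then show "integrable unit_interval (\<lambda>y. V (x, y))"
          by (rule unit_interval_integrable)
      qed
    qed
    then show ?thesis
      by (subst AE_restrict_space_iff) (auto intro: AE_completion simp del: AE_conj_iff)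
  qed
  show "AE x in unit_interval. integrable unit_interval (W x)"
    using *
  proof eventually_elim
    case (elim x)
    then have ae: "AE y in unit_interval. V (x, y) = W x y" and int: "integrable unit_interval (\<lambda>y. V (x, y))"
      by (auto elim: eventually_mono)
    have "W x \<in> borel_measurable unit_interval"
      by (rule unit_interval_AE_measurable[OF _ ae]) (use int in auto)
    then show ?case
      using int ae by (subst integrable_cong_AE[of _ _ "\<lambda>y. V (x, y)"]) (auto elim: eventually_mono)
  qed
  show "(\<lambda>x. \<integral>y. W x y * f y \<partial>unit_interval) \<in> borel_measurable unit_interval"
    if f: "f \<in> borel_measurable unit_interval"
  proof -
    have "(\<lambda>y. if y \<in> ?I then f y else 0) \<in> borel_measurable lebesgue"
      using f by (subst borel_measurable_if) auto
    then obtain g where g [measurable]: "g \<in> borel_measurable lborel"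
      and fg: "AE y in lborel. (if y \<in> ?I then f y else 0) = g y"
      using completion_ex_borel_measurable_real by blast
    define h where "h = (\<lambda>x. \<integral>y. V (x, y) * g y * indicator ?I y \<partial>lborel)"
    have Vm [measurable]: "V \<in> borel_measurable (borel \<Otimes>\<^sub>M borel)"
      using V by (simp add: borel_prod)
    have "h \<in> borel_measurable lborel"
      unfolding h_def by measurable
    then have "h \<in> borel_measurable unit_interval"
      by (intro measurable_restrict_space1 measurable_completion)
    moreover have "AE x in unit_interval. h x = (\<integral>y. W x y * f y \<partial>unit_interval)"
      using *
    proof eventually_elim
      case (elim x)
      then have ae: "AE y in unit_interval. V (x, y) = W x y" and int: "integrable unit_interval (\<lambda>y. V (x, y))"
        by (auto elim: eventually_mono)
      have Wm: "W x \<in> borel_measurable unit_interval"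
        by (rule unit_interval_AE_measurable[OF _ ae]) (use int in auto)
      have "(\<lambda>y. V (x, y) * g y * indicator ?I y) \<in> borel_measurable lborel"
        by measurable
      then have "h x = (\<integral>y. V (x, y) * g y * indicator ?I y \<partial>lebesgue)"
        by (simp add: h_def integral_completion)
      also have "\<dots> = (\<integral>y. V (x, y) * g y \<partial>unit_interval)"
        by (subst integral_restrict_space) (auto intro!: Bochner_Integration.integral_cong)
      also have "\<dots> = (\<integral>y. W x y * f y \<partial>unit_interval)"
      proof (rule integral_cong_AE)
        show "(\<lambda>y. V (x, y) * g y) \<in> borel_measurable unit_interval"
          by (intro measurable_restrict_space1 measurable_completion) measurable
        show "(\<lambda>y. W x y * f y) \<in> borel_measurable unit_interval"
          using Wm f by (rule borel_measurable_times)
        have "AE y in unit_interval. f y = g y"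
          using AE_completion[OF fg] by (subst AE_restrict_space_iff) (auto elim!: eventually_mono)
        with ae show "AE y in unit_interval. V (x, y) * g y = W x y * f y"
          by eventually_elim simp
      qed
      finally show ?case .
    qed
    ultimately show ?thesis
      by (rule unit_interval_AE_measurable)
  qed
qed

lemma integrable_times_ess_bounded:
  assumes "integrable unit_interval k" "f \<in> ess_bounded"
  shows "integrable unit_interval (\<lambda>y. k y * f y :: real)"
proof (rule Bochner_Integration.integrable_bound)
  show "integrable unit_interval (\<lambda>y. k y * Linf_norm f)"
    using assms(1) by simp
  show "(\<lambda>y. k y * f y) \<in> borel_measurable unit_interval"
    using assms by (intro borel_measurable_times) auto
  show "AE y in unit_interval. norm (k y * f y) \<le> norm (k y * Linf_norm f)"
    using AE_Linf_norm(1)[OF assms(2)]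
    by eventually_elim (use AE_Linf_norm(2)[OF assms(2)] in \<open>auto simp: abs_mult intro!: mult_left_mono\<close>)
qed

lemma ess_bounded_const: "(\<lambda>y. c) \<in> ess_bounded"
  by (rule ess_boundedI[where C = "\<bar>c\<bar>"]) auto

lemma AE_unit_interval_space: "AE x in unit_interval. x \<in> {0<..<1}"
  using AE_space[of unit_interval] by simp

context
  fixes W :: "real \<Rightarrow> real \<Rightarrow> real"
  assumes W: "admissible_graphon W"
begin

lemma AE_section_integrable: "AE x in unit_interval. integrable unit_interval (W x)"
  using W by (intro unit_interval_section(1)) (auto simp: admissible_graphon_def)

lemma AE_graphon_laplacian_split:
  assumes f: "f \<in> ess_bounded"
  shows "AE x in unit_interval. graphon_laplacian W f x =
    (\<integral>y. W x y * f y \<partial>unit_interval) - (\<integral>y. W x y * 1 \<partial>unit_interval) * f x"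
  using AE_section_integrable
proof eventually_elim
  case (elim x)
  have "graphon_laplacian W f x = (\<integral>y. W x y * f y - W x y * f x \<partial>unit_interval)"
    by (simp add: graphon_laplacian_def right_diff_distrib)
  also have "\<dots> = (\<integral>y. W x y * f y \<partial>unit_interval) - (\<integral>y. W x y * f x \<partial>unit_interval)"
    using elim f ess_bounded_const by (intro Bochner_Integration.integral_diff integrable_times_ess_bounded)
  finally show ?case by simp
qed

lemma graphon_laplacian_measurable:
  assumes f: "f \<in> ess_bounded"
  shows "graphon_laplacian W f \<in> borel_measurable unit_interval"
proof (rule unit_interval_AE_measurable)
  have int: "integrable (lebesgue_on ({0<..<1} \<times> {0<..<1})) (\<lambda>(x, y). W x y)"
    using W by (simp add: admissible_graphon_def)
  show "(\<lambda>x. (\<integral>y. W x y * f y \<partial>unit_interval) - (\<integral>y. W x y * 1 \<partial>unit_interval) * f x)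
      \<in> borel_measurable unit_interval"
    using f by (intro borel_measurable_diff borel_measurable_times unit_interval_section(2)[OF int]) auto
  show "AE x in unit_interval. (\<integral>y. W x y * f y \<partial>unit_interval) - (\<integral>y. W x y * 1 \<partial>unit_interval) * f x =
      graphon_laplacian W f x"
    using AE_graphon_laplacian_split[OF f] by (auto elim: eventually_mono)
qed

lemma AE_graphon_laplacian_le:
  assumes f: "f \<in> ess_bounded"
  shows "AE x in unit_interval. \<bar>graphon_laplacian W f x\<bar> \<le> 2 * Linf_norm f"
proof -
  have "AE x in unit_interval. (\<integral>y. W x y \<partial>unit_interval) \<le> 1"
    using W by (simp add: admissible_graphon_def)
  then show ?thesis
    using AE_unit_interval_space AE_section_integrable AE_Linf_norm(1)[OF f]
  proof eventually_elim
    case (elim x)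
    have nn: "AE y in unit_interval. 0 \<le> W x y"
      using AE_unit_interval_space
      by eventually_elim (use elim(2) W in \<open>simp add: admissible_graphon_def\<close>)
    have d: "(\<lambda>y. f y - f x) \<in> ess_bounded"
      using f ess_bounded_const by (rule ess_bounded_diff)
    have "\<bar>graphon_laplacian W f x\<bar> \<le> (\<integral>y. \<bar>W x y * (f y - f x)\<bar> \<partial>unit_interval)"
      unfolding graphon_laplacian_def by (rule integral_abs_bound)
    also have "\<dots> \<le> (\<integral>y. W x y * (2 * Linf_norm f) \<partial>unit_interval)"
    proof (rule integral_mono_AE)
      show "integrable unit_interval (\<lambda>y. \<bar>W x y * (f y - f x)\<bar>)"
        using elim d by (intro integrable_abs integrable_times_ess_bounded)
      show "integrable unit_interval (\<lambda>y. W x y * (2 * Linf_norm f))"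
        using elim by simp
      show "AE y in unit_interval. \<bar>W x y * (f y - f x)\<bar> \<le> W x y * (2 * Linf_norm f)"
        using nn AE_Linf_norm(1)[OF f]
        by eventually_elim (use elim in \<open>auto simp: abs_mult intro!: mult_left_mono\<close>)
    qed
    also have "\<dots> = (\<integral>y. W x y \<partial>unit_interval) * (2 * Linf_norm f)"
      by simp
    also have "\<dots> \<le> 1 * (2 * Linf_norm f)"
      using elim AE_Linf_norm(2)[OF f] by (intro mult_right_mono) auto
    finally show ?case by simp
  qed
qed

lemma graphon_laplacian_ess_bounded: "f \<in> ess_bounded \<Longrightarrow> graphon_laplacian W f \<in> ess_bounded"
  using graphon_laplacian_measurable AE_graphon_laplacian_le by (rule ess_boundedI)

lemma graphon_laplacian_cong:
  assumes fg: "AE x in unit_interval. f x = g x" and f: "f \<in> ess_bounded" and g: "g \<in> ess_bounded"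
  shows "AE x in unit_interval. graphon_laplacian W f x = graphon_laplacian W g x"
  using fg AE_section_integrable
proof eventually_elim
  case (elim x)
  show ?case
    unfolding graphon_laplacian_def
  proof (rule integral_cong_AE)
    show "(\<lambda>y. W x y * (f y - f x)) \<in> borel_measurable unit_interval"
      "(\<lambda>y. W x y * (g y - g x)) \<in> borel_measurable unit_interval"
      using elim f g by (auto intro!: borel_measurable_times borel_measurable_diff)
    show "AE y in unit_interval. W x y * (f y - f x) = W x y * (g y - g x)"
      using fg by eventually_elim (simp add: elim)
  qed
qed

lemma graphon_laplacian_to_Linf:
  "f \<in> ess_bounded \<Longrightarrow>
    to_Linf (graphon_laplacian W (rep_Linf (to_Linf f))) = to_Linf (graphon_laplacian W f)"
  by (simp add: to_Linf_eq_iff graphon_laplacian_ess_bounded graphon_laplacian_cong AE_rep_to_Linf)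

lemma bounded_linear_graphon_laplacian:
  "bounded_linear (\<lambda>u. to_Linf (graphon_laplacian W (rep_Linf u)))"
proof (rule bounded_linear_intro[where K = 2])
  note eb = graphon_laplacian_ess_bounded ess_bounded_add ess_bounded_scale
  fix u v :: Linf and c :: real
  let ?f = "rep_Linf u" and ?g = "rep_Linf v"
  have "to_Linf (graphon_laplacian W (rep_Linf (u + v))) = to_Linf (graphon_laplacian W (\<lambda>x. ?f x + ?g x))"
    using graphon_laplacian_to_Linf[OF ess_bounded_add[of ?f ?g]] to_Linf_add[of ?f ?g] by simp
  also have "\<dots> = to_Linf (\<lambda>x. graphon_laplacian W ?f x + graphon_laplacian W ?g x)"
  proof (subst to_Linf_eq_iff)
    show "AE x in unit_interval. graphon_laplacian W (\<lambda>x. ?f x + ?g x) x =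
        graphon_laplacian W ?f x + graphon_laplacian W ?g x"
      using AE_section_integrable
    proof eventually_elim
      case (elim x)
      have "graphon_laplacian W (\<lambda>x. ?f x + ?g x) x =
          (\<integral>y. W x y * (?f y - ?f x) + W x y * (?g y - ?g x) \<partial>unit_interval)"
        by (simp add: graphon_laplacian_def algebra_simps)
      also have "\<dots> = graphon_laplacian W ?f x + graphon_laplacian W ?g x"
        unfolding graphon_laplacian_def using elim
        by (intro Bochner_Integration.integral_add integrable_times_ess_bounded
            ess_bounded_diff ess_bounded_const rep_Linf_ess_bounded)
      finally show ?case .
    qed
  qed (simp_all add: eb)
  finally show "to_Linf (graphon_laplacian W (rep_Linf (u + v))) =
      to_Linf (graphon_laplacian W ?f) + to_Linf (graphon_laplacian W ?g)"
    by (simp add: to_Linf_add eb)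
  have "to_Linf (graphon_laplacian W (rep_Linf (c *\<^sub>R u))) = to_Linf (graphon_laplacian W (\<lambda>x. c * ?f x))"
    using graphon_laplacian_to_Linf[OF ess_bounded_scale[of ?f c]] to_Linf_scaleR[of ?f c] by simp
  also have "graphon_laplacian W (\<lambda>x. c * ?f x) = (\<lambda>x. c * graphon_laplacian W ?f x)"
    by (simp add: graphon_laplacian_def fun_eq_iff mult.left_commute flip: right_diff_distrib)
  finally show "to_Linf (graphon_laplacian W (rep_Linf (c *\<^sub>R u))) =
      c *\<^sub>R to_Linf (graphon_laplacian W ?f)"
    by (simp add: to_Linf_scaleR eb)
  show "norm (to_Linf (graphon_laplacian W ?f)) \<le> norm u * 2"
    using AE_Linf_norm(3)[OF graphon_laplacian_ess_bounded AE_graphon_laplacian_le, of ?f]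
    by (simp add: norm_to_Linf norm_Linf_eq[of u] eb)
qed

lemma graphon_operator_apply:
  "blinfun_apply (graphon_operator W) u = to_Linf (graphon_laplacian W (rep_Linf u))"
  by (simp add: graphon_operator_def bounded_linear_Blinfun_apply bounded_linear_graphon_laplacian)

lemma graphon_operator_to_Linf:
  "f \<in> ess_bounded \<Longrightarrow> blinfun_apply (graphon_operator W) (to_Linf f) = to_Linf (graphon_laplacian W f)"
  by (simp add: graphon_operator_apply graphon_laplacian_to_Linf)

end

text \<open>\<open>Linf \<Rightarrow>\<^sub>L Linf\<close> is not an instance of \<open>real_normed_algebra_1\<close>, so the library's \<open>exp\<close> does
  not apply to it; the series below converges in operator norm.\<close>

definition blinfun_exp :: "('a::banach \<Rightarrow>\<^sub>L 'a) \<Rightarrow> 'a \<Rightarrow>\<^sub>L 'a"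
  where "blinfun_exp A = (\<Sum>n. (((o\<^sub>L) A ^^ n) id_blinfun) /\<^sub>R fact n)"

lemma norm_blinfun_power_le:
  fixes A :: "'a::banach \<Rightarrow>\<^sub>L 'a"
  shows "norm (((o\<^sub>L) A ^^ n) id_blinfun) \<le> norm A ^ n"
proof (induction n)
  case 0
  show ?case by (simp add: norm_blinfun_id_le)
next
  case (Suc n)
  then show ?case
    using norm_blinfun_compose[of A "((o\<^sub>L) A ^^ n) id_blinfun"]
    by (simp add: order_trans mult_left_mono)
qed

lemma summable_blinfun_exp: "summable (\<lambda>n. (((o\<^sub>L) A ^^ n) id_blinfun) /\<^sub>R fact n)"
  for A :: "'a::banach \<Rightarrow>\<^sub>L 'a"
proof (rule summable_comparison_test)
  show "summable (\<lambda>n. norm A ^ n /\<^sub>R fact n)"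
    by (rule summable_exp_generic)
  show "\<exists>N. \<forall>n\<ge>N. norm ((((o\<^sub>L) A ^^ n) id_blinfun) /\<^sub>R fact n) \<le> norm A ^ n /\<^sub>R fact n"
    by (simp add: norm_blinfun_power_le divide_right_mono)
qed

definition graphon_semigroup :: "(real \<Rightarrow> real \<Rightarrow> real) \<Rightarrow> real \<Rightarrow> Linf \<Rightarrow>\<^sub>L Linf"
  where "graphon_semigroup W t = blinfun_exp (t *\<^sub>R graphon_operator W)"

section \<open>The graphon reaction--diffusion equation\<close>

text \<open>The operators are defined through representatives; \<open>superposition_to_Linf\<close> shows independence
  of the choice (as \<open>graphon_operator_to_Linf\<close> does for the diffusion operator).\<close>

definition superposition :: "(real \<Rightarrow> real) \<Rightarrow> Linf \<Rightarrow> Linf"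
  where "superposition \<Phi> u = to_Linf (\<lambda>x. \<Phi> (rep_Linf u x))"

definition locally_lipschitz :: "(real \<Rightarrow> real) \<Rightarrow> bool"
  where "locally_lipschitz \<Phi> \<longleftrightarrow> (\<forall>B. bounded B \<longrightarrow> (\<exists>L. L-lipschitz_on B \<Phi>))"

lemma superposition_to_Linf:
  assumes \<Phi>: "locally_lipschitz \<Phi>" and f: "f \<in> ess_bounded"
  shows "(\<lambda>x. \<Phi> (f x)) \<in> ess_bounded" and "superposition \<Phi> (to_Linf f) = to_Linf (\<lambda>x. \<Phi> (f x))"
proof -
  have "isCont \<Phi> x" for x
  proof -
    obtain L where "L-lipschitz_on (ball x 1) \<Phi>"
      using \<Phi> by (auto simp: locally_lipschitz_def)
    then have "continuous_on (ball x 1) \<Phi>"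
      by (rule lipschitz_on_continuous_on)
    then show ?thesis by (simp add: continuous_on_eq_continuous_at)
  qed
  then have cont: "continuous_on A \<Phi>" for A
    by (simp add: continuous_at_imp_continuous_on)
  have *: "(\<lambda>x. \<Phi> (g x)) \<in> ess_bounded" if g: "g \<in> ess_bounded" for g
  proof -
    have "compact (\<Phi> ` {- Linf_norm g .. Linf_norm g})"
      by (intro compact_continuous_image cont) simp
    then obtain C where "\<forall>z\<in>\<Phi> ` {- Linf_norm g .. Linf_norm g}. \<bar>z\<bar> \<le> C"
      using compact_imp_bounded bounded_real by metis
    then have C: "\<bar>\<Phi> y\<bar> \<le> C" if "\<bar>y\<bar> \<le> Linf_norm g" for y
      using that by (simp add: abs_le_iff)
    have "(\<lambda>x. \<Phi> (g x)) \<in> borel_measurable unit_interval"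
      using measurable_compose[OF ess_bounded_measurable[OF g] borel_measurable_continuous_onI[OF cont]] .
    moreover have "AE x in unit_interval. \<bar>\<Phi> (g x)\<bar> \<le> C"
      using AE_Linf_norm(1)[OF g] by eventually_elim (rule C)
    ultimately show ?thesis by (rule ess_boundedI)
  qed
  show "(\<lambda>x. \<Phi> (f x)) \<in> ess_bounded" by (rule *[OF f])
  show "superposition \<Phi> (to_Linf f) = to_Linf (\<lambda>x. \<Phi> (f x))"
    unfolding superposition_def
  proof (subst to_Linf_eq_iff)
    show "AE x in unit_interval. \<Phi> (rep_Linf (to_Linf f) x) = \<Phi> (f x)"
      using AE_rep_to_Linf[OF f] by eventually_elim simp
  qed (simp_all add: * f)
qed

definition C1_on :: "real set \<Rightarrow> (real \<Rightarrow> 'a::real_normed_vector) \<Rightarrow> bool"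
  where "C1_on I u \<longleftrightarrow>
    (\<exists>u'. continuous_on I u' \<and> (\<forall>t\<in>I. (u has_vector_derivative u' t) (at t within I)))"

definition classical_solution ::
    "(real \<Rightarrow> real \<Rightarrow> real) \<Rightarrow> (real \<Rightarrow> real) \<Rightarrow> Linf \<Rightarrow> real set \<Rightarrow> (real \<Rightarrow> Linf) \<Rightarrow> bool"
  where "classical_solution W \<Phi> u\<^sub>0 I u \<longleftrightarrow>
    C1_on I u \<and> u 0 = u\<^sub>0 \<and>
    (\<forall>t\<in>I. (u has_vector_derivative graphon_operator W (u t) + superposition \<Phi> (u t)) (at t within I))"

text \<open>The Bochner integral of the library needs a second countable codomain, which \<open>Linf\<close> is not; the
  integral is therefore the Henstock--Kurzweil one, which for continuous integrands is the
  Riemann (and Bochner) integral.\<close>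

definition mild_formulation ::
    "(real \<Rightarrow> real \<Rightarrow> real) \<Rightarrow> (real \<Rightarrow> real) \<Rightarrow> Linf \<Rightarrow> real set \<Rightarrow> (real \<Rightarrow> Linf) \<Rightarrow> bool"
  where "mild_formulation W \<Phi> u\<^sub>0 I u \<longleftrightarrow>
    (\<forall>t\<in>I. (\<lambda>s. graphon_semigroup W (t - s) (superposition \<Phi> (u s))) integrable_on {0..t} \<and>
      u t = graphon_semigroup W t u\<^sub>0
        + integral {0..t} (\<lambda>s. graphon_semigroup W (t - s) (superposition \<Phi> (u s))))"

end

theory Submission
  imports Defs
begin

text \<open>Both the diffusion operator and the superposition operator are Lipschitz on bounded subsets of
  \<open>L\<^sup>\<infinity>\<close>, so the equation is an autonomous ODE in a Banach space. Picard iteration gives a solution on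
  an interval whose length depends only on a bound for the norm of the initial value. Hence the
  supremum of the existence times is not attained, and near a finite supremum the norm exceeds every
  bound, since otherwise the solution could be continued past it. The mild formulation is the
  fundamental theorem of calculus applied to \<open>s \<mapsto> e\<^bsup>(t - s)L\<^esup> u(s)\<close>.\<close>

section \<open>Autonomous differential equations in Banach spaces\<close>

definition ode_solution :: "('a::real_normed_vector \<Rightarrow> 'a) \<Rightarrow> real set \<Rightarrow> (real \<Rightarrow> 'a) \<Rightarrow> bool"
  where "ode_solution f I u \<longleftrightarrow> (\<forall>t\<in>I. (u has_vector_derivative f (u t)) (at t within I))"

lemma ode_solution_subset: "ode_solution f I u \<Longrightarrow> J \<subseteq> I \<Longrightarrow> ode_solution f J u"
  by (auto simp: ode_solution_def intro: has_vector_derivative_within_subset)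

lemma ode_solution_continuous: "ode_solution f I u \<Longrightarrow> continuous_on I u"
  unfolding ode_solution_def continuous_on_eq_continuous_within
  using has_vector_derivative_continuous by blast

lemma ode_solution_cong:
  assumes "ode_solution f I v" and "\<And>t. t \<in> I \<Longrightarrow> u t = v t"
  shows "ode_solution f I u"
  unfolding ode_solution_def
proof
  fix t assume "t \<in> I"
  with assms show "(u has_vector_derivative f (u t)) (at t within I)"
    by (intro has_vector_derivative_transform[OF _ assms(2)]) (auto simp: ode_solution_def)
qed

text \<open>At the junction both one-sided derivatives equal \<open>f\<close> of the common value
  \<open>u b = v b\<close>, so the glued function is differentiable there as well.\<close>

lemma ode_solution_append:
  assumes u: "ode_solution f {a..b} u" and v: "ode_solution f {b..c} v" and eq: "u b = v b"
    and le: "a \<le> b" "b \<le> c"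
  shows "ode_solution f {a..c} (\<lambda>t. if t \<le> b then u t else v t)"
proof (rule ode_solution_cong)
  let ?w = "\<lambda>t. if t \<in> {a..b} then u t else v t"
  show "ode_solution f {a..c} ?w"
    unfolding ode_solution_def
  proof
    fix t assume t: "t \<in> {a..c}"
    have "(?w has_vector_derivative (if t \<in> {a..b} then f (u t) else f (v t))) (at t within {a..c})"
    proof (rule has_vector_derivative_If_within_closures)
      show "t \<in> {a..b} \<union> {b..c}" "{a..c} = {a..b} \<union> {b..c}"
        using t le by auto
      have *: "{a..b} \<union> (closure {a..b} \<inter> closure {b..c}) = {a..b}"
          "{b..c} \<union> (closure {a..b} \<inter> closure {b..c}) = {b..c}"
        by auto
      show "(u has_vector_derivative f (u t)) (at t within {a..b} \<union> (closure {a..b} \<inter> closure {b..c}))"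
        if "t \<in> {a..b} \<union> (closure {a..b} \<inter> closure {b..c})"
        using that u unfolding * ode_solution_def by blast
      show "(v has_vector_derivative f (v t)) (at t within {b..c} \<union> (closure {a..b} \<inter> closure {b..c}))"
        if "t \<in> {b..c} \<union> (closure {a..b} \<inter> closure {b..c})"
        using that v unfolding * ode_solution_def by blast
    next
      assume "t \<in> closure {a..b}" "t \<in> closure {b..c}"
      then have "t = b" by simp
      then show "u t = v t" "f (u t) = f (v t)" by (simp_all add: eq)
    qed
    then show "(?w has_vector_derivative f (?w t)) (at t within {a..c})"
      by (simp only: if_distrib[of f])
  qed
qed auto

text \<open>On a compact interval both solutions stay in one ball, where a single Lipschitz constant
  \<open>L\<close> is available. Measuring their difference in an exponentially weighted sup norm
  (Bielecki's device) then does the work of a Gronwall inequality.\<close>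

lemma ode_solution_unique:
  fixes f :: "'a::real_normed_vector \<Rightarrow> 'a"
  assumes lip: "\<And>R. \<exists>L. L-lipschitz_on (cball 0 R) f"
    and u: "ode_solution f {a..b} u" and v: "ode_solution f {a..b} v"
    and init: "u a = v a" and t: "t \<in> {a..b}"
  shows "u t = v t"
proof -
  note cont = ode_solution_continuous[OF u] ode_solution_continuous[OF v]
  have "bounded (u ` {a..b} \<union> v ` {a..b})"
    using cont by (auto intro!: compact_imp_bounded compact_continuous_image)
  then obtain R where R: "\<And>s. s \<in> {a..b} \<Longrightarrow> u s \<in> cball 0 R \<and> v s \<in> cball 0 R"
    unfolding bounded_iff by fastforce
  obtain L where L: "L-lipschitz_on (cball 0 R) f"
    using lip by blast
  \<comment> \<open>The weighted norm turns the Lipschitz bound into \<open>w m \<le> w m / 2\<close> at a maximum point \<open>m\<close>.\<close>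
  define w where "w = (\<lambda>s. exp (- 2 * L * (s - a)) * norm (u s - v s))"
  have w_eq: "norm (u s - v s) = exp (2 * L * (s - a)) * w s" for s
    by (simp add: w_def exp_minus)
  have "continuous_on {a..b} w"
    unfolding w_def by (intro continuous_intros cont)
  then obtain m where m: "m \<in> {a..b}" "\<And>s. s \<in> {a..b} \<Longrightarrow> w s \<le> w m"
    using continuous_attains_sup[of "{a..b}" w] t by fastforce
  have "w m \<le> 0"
  proof (cases "m = a")
    case True
    then show ?thesis by (simp add: w_def init)
  next
    case False
    \<comment> \<open>The derivative of this majorant is
      \<open>w m * L * exp (2 * L * (s - a))\<close>, which dominates the derivative of
      \<open>u - v\<close> because \<open>w s \<le> w m\<close>. The factor 2 in the exponent of the
      weight is the source of the gain \<open>w m / 2\<close>.\<close>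
    let ?\<phi> = "\<lambda>s. w m / 2 * exp (2 * L * (s - a))"
    have "norm ((u m - v m) - (u a - v a)) \<le> ?\<phi> m - ?\<phi> a"
    proof (rule differentiable_bound_general[where f = "\<lambda>s. u s - v s" and \<phi> = ?\<phi>])
      show "a < m" using m False by auto
      have "{a..m} \<subseteq> {a..b}" using m by auto
      then show "continuous_on {a..m} (\<lambda>s. u s - v s)"
        using cont by (intro continuous_intros) (auto elim: continuous_on_subset)
      show "continuous_on {a..m} ?\<phi>"
        by (intro continuous_intros)
    next
      fix s assume s: "a < s" "s < m"
      then have ab: "s \<in> {a..b}" "at s within {a..b} = at s"
        using m by (auto simp: at_within_Icc_at)
      show "((\<lambda>s. u s - v s) has_vector_derivative f (u s) - f (v s)) (at s)"
        using u v ab by (intro has_vector_derivative_diff) (metis ode_solution_def)+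
      show "(?\<phi> has_vector_derivative w m * L * exp (2 * L * (s - a))) (at s)"
        unfolding has_real_derivative_iff_has_vector_derivative[symmetric]
        by (auto intro!: derivative_eq_intros)
      have "norm (f (u s) - f (v s)) \<le> L * (exp (2 * L * (s - a)) * w s)"
        using lipschitz_onD[OF L] R[OF ab(1)] by (simp add: dist_norm flip: w_eq)
      also have "\<dots> \<le> L * (exp (2 * L * (s - a)) * w m)"
        using m(2)[OF ab(1)] lipschitz_on_nonneg[OF L] by (intro mult_left_mono) auto
      finally show "norm (f (u s) - f (v s)) \<le> w m * L * exp (2 * L * (s - a))"
        by (simp add: mult_ac)
    qed
    then have "exp (2 * L * (m - a)) * w m \<le> w m / 2 * exp (2 * L * (m - a)) - w m / 2"
      by (simp add: init w_eq)
    moreover have "0 \<le> w m" by (simp add: w_def)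
    ultimately have "exp (2 * L * (m - a)) * w m \<le> exp (2 * L * (m - a)) * (w m / 2)"
      by (simp add: mult.commute)
    then show ?thesis by simp
  qed
  then have "w t \<le> 0" using m(2)[OF t] by simp
  then show ?thesis by (simp add: w_def mult_le_0_iff)
qed

text \<open>Banach's fixed point theorem for the Picard operator. The order of the quantifiers
  matters: one \<open>h\<close> serves every starting time and every initial value of norm at most
  \<open>R\<close>, and continuation rests on this uniformity.\<close>

lemma ode_solution_local_exists:
  fixes f :: "'a::banach \<Rightarrow> 'a"
  assumes lip: "\<And>R. \<exists>L. L-lipschitz_on (cball 0 R) f"
  obtains h where "h > 0"
    and "\<And>x a. norm x \<le> R \<Longrightarrow> \<exists>u. u a = x \<and> ode_solution f {a..a + h} u"
proof -
  obtain L where L: "L-lipschitz_on (cball 0 (R + 1)) f"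
    using lip by blast
  \<comment> \<open>\<open>B\<close> will bound \<open>norm (f y)\<close> on the ball of radius
    \<open>R + 1\<close>; the absolute value keeps \<open>B\<close> nonnegative for every real
    \<open>R\<close>.\<close>
  define B where "B = L * \<bar>R + 1\<bar> + norm (f 0)"
  \<comment> \<open>The first term makes the Picard operator a contraction with factor 1/2, the
    second keeps its values within distance 1 of the initial value. Adding 1 in the denominators
    avoids division by zero.\<close>
  define h where "h = min (1 / (2 * (L + 1))) (1 / (B + 1))"
  note L0 = lipschitz_on_nonneg[OF L]
  then have B0: "0 \<le> B" by (simp add: B_def)
  have h: "h > 0" "B * h \<le> 1" "L * h \<le> 1 / 2"
  proof -
    show "h > 0" using L0 B0 by (simp add: h_def)
    have "B * h \<le> B * (1 / (B + 1))" using B0 by (intro mult_left_mono) (simp_all add: h_def)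
    also have "\<dots> \<le> 1" using B0 by (simp add: field_simps)
    finally show "B * h \<le> 1" .
    have "L * h \<le> L * (1 / (2 * (L + 1)))" using L0 by (intro mult_left_mono) (simp_all add: h_def)
    also have "\<dots> \<le> 1 / 2" using L0 by (simp add: field_simps)
    finally show "L * h \<le> 1 / 2" .
  qed
  have fB: "norm (f y) \<le> B" if "norm y \<le> R + 1" for y
  proof -
    have "0 \<le> R + 1" using that norm_ge_zero order_trans by blast
    then have "norm (f y - f 0) \<le> L * norm y"
      using lipschitz_onD[OF L, of y 0] that by (simp add: dist_norm)
    also have "\<dots> \<le> L * \<bar>R + 1\<bar>" using that L0 by (intro mult_left_mono) auto
    finally show ?thesis
      using norm_triangle_sub[of "f y" "f 0"] by (simp add: B_def)
  qed
  have "\<exists>u. u a = x \<and> ode_solution f {a..a + h} u" if x: "norm x \<le> R" for x a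
  proof -
    \<comment> \<open>The fixed point is sought among bounded continuous functions on the whole
      line. Clamping time to \<open>{a..a + h}\<close> keeps the Picard integrals bounded there and
      changes nothing on the interval itself.\<close>
    define c where "c = (\<lambda>t. max a (min (a + h) t))"
    have c: "a \<le> c t" "c t \<le> a + h" "c t \<in> {a..a + h}" for t
      using h by (auto simp: c_def)
    have c_eq: "c t = t" if "t \<in> {a..a + h}" for t
      using that by (simp add: c_def)
    have c_cont: "continuous_on UNIV c"
      unfolding c_def by (intro continuous_intros)
    \<comment> \<open>Functions within distance 1 of \<open>x\<close> take values in the ball of
      radius \<open>R + 1\<close>, so \<open>L\<close> and \<open>B\<close> apply to them; the set
      is closed, hence complete.\<close>
    define K where "K = PiC (UNIV :: real set) (\<lambda>_. cball x 1)"
    have K_iff: "v \<in> K \<longleftrightarrow> (\<forall>t. dist x (apply_bcontfun v t) \<le> 1)" for v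
      by (auto simp: K_def mem_PiC_iff)
    have K: "apply_bcontfun v t \<in> cball 0 (R + 1)" if "v \<in> K" for v t
    proof -
      have "norm (apply_bcontfun v t) \<le> norm x + dist x (apply_bcontfun v t)"
        by (metis dist_norm dist_commute norm_triangle_sub)
      then show ?thesis
        using that x unfolding K_iff by (auto dest: spec[of _ t])
    qed
    have fv_cont: "continuous_on S (\<lambda>t. f (apply_bcontfun v t))" if "v \<in> K" for v S
      by (rule continuous_on_compose2[OF lipschitz_on_continuous_on[OF L] continuous_on_apply_bcontfun])
        (use K[OF that] in auto)
    define p where "p = (\<lambda>v t. x + integral {a..c t} (\<lambda>s. f (apply_bcontfun v s)))"
    have p_close: "norm (p v t - x) \<le> 1" if "v \<in> K" for v t
    proof -
      have "norm (p v t - x) \<le> B * (c t - a)"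
        unfolding p_def add_diff_cancel_left'
        using K[OF that] by (intro integral_bound fv_cont that fB c) simp
      also have "\<dots> \<le> B * h" using c(2)[of t] B0 by (intro mult_left_mono) auto
      finally show ?thesis using h by simp
    qed
    \<comment> \<open>\<open>Bcontfun\<close> is meaningful only on bounded continuous functions;
      for \<open>p v\<close> with \<open>v \<in> K\<close> this is checked next.\<close>
    define P where "P = (\<lambda>v. Bcontfun (p v))"
    have P: "apply_bcontfun (P v) = p v" if "v \<in> K" for v
    proof -
      have "continuous_on UNIV (p v)"
        unfolding p_def
        by (intro continuous_intros
            continuous_on_compose2[OF indefinite_integral_continuous_1[OF integrable_continuous_real] c_cont]
            fv_cont that) (use c in auto)
      moreover have "norm (p v t) \<le> norm x + 1" for t
        using p_close[OF that, of t] norm_triangle_sub[of "p v t" x] by simp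
      ultimately have "p v \<in> bcontfun" by (rule bcontfun_normI)
      then show ?thesis by (simp add: P_def Bcontfun_inverse)
    qed
    have "\<exists>!v\<in>K. P v = v"
    proof (rule Banach_fix)
      show "complete K"
        unfolding K_def by (simp add: complete_eq_closed closed_PiC)
      show "K \<noteq> {}"
        using K_iff[of "const_bcontfun x"] by (auto simp: const_bcontfun.rep_eq)
      show "P ` K \<subseteq> K"
        using p_close by (auto simp: K_iff P dist_norm norm_minus_commute)
      fix v w assume v: "v \<in> K" and w: "w \<in> K"
      show "dist (P v) (P w) \<le> 1 / 2 * dist v w"
      proof (rule dist_bound)
        fix t
        have "p v t - p w t = integral {a..c t} (\<lambda>s. f (apply_bcontfun v s) - f (apply_bcontfun w s))"
          unfolding p_def by (simp add: integral_diff integrable_continuous_real fv_cont v w)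
        also have "norm \<dots> \<le> L * dist v w * (c t - a)"
        proof (rule integral_bound)
          fix s
          have "norm (f (apply_bcontfun v s) - f (apply_bcontfun w s))
              \<le> L * dist (apply_bcontfun v s) (apply_bcontfun w s)"
            using lipschitz_onD[OF L K[OF v] K[OF w]] by (simp add: dist_norm)
          also have "\<dots> \<le> L * dist v w"
            using L0 dist_bounded by (rule mult_left_mono[rotated])
          finally show "norm (f (apply_bcontfun v s) - f (apply_bcontfun w s)) \<le> L * dist v w" .
        qed (use c in \<open>auto intro!: continuous_intros fv_cont v w\<close>)
        also have "\<dots> \<le> L * dist v w * h"
          using c(2)[of t] L0 by (intro mult_left_mono) auto
        also have "\<dots> = L * h * dist v w" by simp
        also have "\<dots> \<le> 1 / 2 * dist v w"
          using h by (intro mult_right_mono) auto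
        finally show "dist (apply_bcontfun (P v) t) (apply_bcontfun (P w) t) \<le> 1 / 2 * dist v w"
          by (simp add: P v w dist_norm)
      qed
    qed auto
    then obtain v where v: "v \<in> K" "P v = v" by blast
    then have v_eq: "apply_bcontfun v = p v"
      using P by metis
    have "ode_solution f {a..a + h} (apply_bcontfun v)"
      unfolding ode_solution_def
    proof
      fix t assume t: "t \<in> {a..a + h}"
      show "(apply_bcontfun v has_vector_derivative f (apply_bcontfun v t)) (at t within {a..a + h})"
      \<comment> \<open>On the interval the clamp is the identity, so the fixed point equation
        becomes the integral equation, whose right-hand side is differentiable because its integrand
        is continuous.\<close>
      proof (rule has_vector_derivative_transform[OF t])
        show "apply_bcontfun v s = x + integral {a..s} (\<lambda>s. f (apply_bcontfun v s))"
          if "s \<in> {a..a + h}" for s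
          using that fun_cong[OF v_eq, of s] by (simp add: p_def c_eq)
        have "((\<lambda>s. x + integral {a..s} (\<lambda>s. f (apply_bcontfun v s))) has_vector_derivative
            0 + f (apply_bcontfun v t)) (at t within {a..a + h})"
          by (intro has_vector_derivative_add has_vector_derivative_const
              integral_has_vector_derivative fv_cont v t)
        then show "((\<lambda>s. x + integral {a..s} (\<lambda>s. f (apply_bcontfun v s))) has_vector_derivative
            f (apply_bcontfun v t)) (at t within {a..a + h})"
          by simp
      qed
    qed
    moreover have "apply_bcontfun v a = x"
      using fun_cong[OF v_eq, of a] h by (simp add: p_def c_eq)
    ultimately show ?thesis by blast
  qed
  with h(1) show ?thesis by (rule that)
qed

text \<open>The blow-up is a full limit and not mere unboundedness: for each bound \<open>K\<close>
  one step length \<open>h\<close> works at every time, so a norm below \<open>K\<close> at any time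
  within \<open>h\<close> of a finite \<open>Tmax\<close> would allow continuation beyond it. Global
  existence is the case \<open>Tmax = \<infinity>\<close>.\<close>

lemma ode_solution_maximal:
  fixes f :: "'a::banach \<Rightarrow> 'a"
  assumes lip: "\<And>R. \<exists>L. L-lipschitz_on (cball 0 R) f"
  obtains Tmax :: ereal and u
  where "0 < Tmax" "u 0 = x" "ode_solution f {t. 0 \<le> t \<and> ereal t < Tmax} u"
    and "Tmax < \<infinity> \<Longrightarrow> filterlim (\<lambda>t. norm (u t)) at_top (at_left (real_of_ereal Tmax))"
proof -
  define sol where "sol = (\<lambda>T v. v 0 = x \<and> ode_solution f {0..T} v)"
  define S where "S = {T. 0 \<le> T \<and> (\<exists>v. sol T v)}"
  define Tmax where "Tmax = (SUP T\<in>S. ereal T)"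
  \<comment> \<open>A solution on \<open>{0..t}\<close> is chosen anew for each \<open>t\<close> and
    read off at its right endpoint. By uniqueness the choices are coherent, so \<open>u\<close>
    agrees with every solution wherever that solution is defined.\<close>
  define u where "u = (\<lambda>t. (SOME v. sol t v) t)"
  have u_eq: "u t = v t" if v: "sol T v" and t: "0 \<le> t" "t \<le> T" for T t v
  proof -
    have "sol t v"
      using v t ode_solution_subset[of f "{0..T}" v "{0..t}"] by (auto simp: sol_def)
    define w where "w = (SOME v. sol t v)"
    have "sol t w"
      unfolding w_def using \<open>sol t v\<close> by (rule someI[of "sol t"])
    with \<open>sol t v\<close> have "w t = v t"
      using t ode_solution_unique[OF lip, of 0 t w v] by (simp add: sol_def)
    then show ?thesis by (simp add: u_def w_def)
  qed
  have extend: "t + h \<in> S"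
    if S: "t \<in> S" and h: "h > 0" and local: "\<And>a. \<exists>w. w a = u t \<and> ode_solution f {a..a + h} w" for t h
  proof -
    obtain v where v: "sol t v" and t: "0 \<le> t" using S by (auto simp: S_def)
    obtain w where w: "w t = u t" "ode_solution f {t..t + h} w" using local by blast
    have "sol (t + h) (\<lambda>s. if s \<le> t then v s else w s)"
      using v w t h u_eq[OF v t order_refl] by (auto simp: sol_def intro!: ode_solution_append)
    then show ?thesis using t h by (auto simp: S_def)
  qed
  have u_S: "ode_solution f {0..T} u" if T: "T \<in> S" for T
  proof -
    obtain v where v: "sol T v" using T by (auto simp: S_def)
    then have "ode_solution f {0..T} v" by (simp add: sol_def)
    then show ?thesis by (rule ode_solution_cong) (use u_eq[OF v] in simp)
  qed
  \<comment> \<open>Differentiability within a single point imposes no condition, so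
    \<open>S\<close> is nonempty; as its elements lie strictly below \<open>Tmax\<close>, this
    yields \<open>0 < Tmax\<close>.\<close>
  have "ode_solution f {0..0} (\<lambda>_. x)"
    by (simp add: ode_solution_def has_vector_derivative_def has_derivative_within_singleton_iff
        bounded_linear_scaleR_left)
  then have zero: "sol 0 (\<lambda>_. x)" by (simp add: sol_def)
  then have zero_S: "0 \<in> S" by (auto simp: S_def)
  have less_Tmax: "ereal T < Tmax" if T: "T \<in> S" for T
  proof -
    obtain h where "h > 0" "\<And>y a. norm y \<le> norm (u T) \<Longrightarrow> \<exists>w. w a = y \<and> ode_solution f {a..a + h} w"
      using ode_solution_local_exists[OF lip] by metis
    then have "T + h \<in> S" using extend[OF T] by blast
    have "ereal T < ereal (T + h)" using \<open>h > 0\<close> by simp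
    also have "\<dots> \<le> Tmax" unfolding Tmax_def using \<open>T + h \<in> S\<close> by (rule SUP_upper)
    finally show ?thesis .
  qed
  have S_I: "\<exists>T\<in>S. t < T" if "ereal t < Tmax" for t
    using that by (auto simp: Tmax_def less_SUP_iff)
  have in_S: "t \<in> S" if t: "0 \<le> t" "ereal t < Tmax" for t
  proof -
    obtain T where T: "T \<in> S" "t < T" using S_I t(2) by blast
    obtain v where "sol T v" using T by (auto simp: S_def)
    then have "sol t v"
      using T ode_solution_subset[of f "{0..T}" v "{0..t}"] by (auto simp: sol_def)
    then show ?thesis using t by (auto simp: S_def)
  qed
  show thesis
  proof
    show "0 < Tmax" using less_Tmax[OF zero_S] by (simp add: zero_ereal_def)
    show "u 0 = x" using u_eq[OF zero] by simp
    show "ode_solution f {t. 0 \<le> t \<and> ereal t < Tmax} u"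
      unfolding ode_solution_def
    proof clarify
      fix t assume t: "0 \<le> t" "ereal t < Tmax"
      obtain T where T: "T \<in> S" "t < T" using S_I t by blast
      have "s < T \<Longrightarrow> ereal s < Tmax" for s
        using less_Tmax[OF T(1)] less_trans[of "ereal s" "ereal T" Tmax] by simp
      \<comment> \<open>Derivatives are local: below \<open>T\<close>, which exceeds
        \<open>t\<close>, the half-open interval and \<open>{0..T}\<close> have the same
        points.\<close>
      then have "at t within {t. 0 \<le> t \<and> ereal t < Tmax} = at t within {0..T}"
        by (intro at_within_nhd[where S = "{..<T}"]) (use T in auto)
      then show "(u has_vector_derivative f (u t)) (at t within {t. 0 \<le> t \<and> ereal t < Tmax})"
        using u_S[OF T(1)] T t by (auto simp: ode_solution_def)
    qed
  next
    assume "Tmax < \<infinity>"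
    then obtain T where T: "Tmax = ereal T"
      using less_Tmax[OF zero_S] by (cases Tmax) auto
    have "\<forall>\<^sub>F t in at_left T. K \<le> norm (u t)" for K
    proof -
      obtain h where h: "h > 0" "\<And>y a. norm y \<le> K \<Longrightarrow> \<exists>w. w a = y \<and> ode_solution f {a..a + h} w"
        using ode_solution_local_exists[OF lip] by metis
      have "K \<le> norm (u t)" if "max 0 (T - h) < t" "t < T" for t
      proof (rule ccontr)
        assume "\<not> K \<le> norm (u t)"
        then have "t + h \<in> S" using that by (intro extend in_S h) (auto simp: T)
        then show False using less_Tmax[of "t + h"] that by (simp add: T)
      qed
      moreover have "max 0 (T - h) < T"
        using h less_Tmax[OF zero_S] by (simp add: T)
      ultimately show ?thesis
        by (intro eventually_at_leftI[of "max 0 (T - h)"]) auto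
    qed
    then show "filterlim (\<lambda>t. norm (u t)) at_top (at_left (real_of_ereal Tmax))"
      by (simp add: filterlim_at_top T)
  qed
qed

section \<open>The exponential of a bounded operator\<close>

lemma blinfun_power_scaleR:
  fixes A :: "'a::banach \<Rightarrow>\<^sub>L 'a"
  shows "((o\<^sub>L) (c *\<^sub>R A) ^^ n) id_blinfun = c ^ n *\<^sub>R ((o\<^sub>L) A ^^ n) id_blinfun"
  by (induction n) (simp_all add: blinfun_eqI blinfun.bilinear_simps)

lemma blinfun_exp_scaleR_sums:
  fixes A :: "'a::banach \<Rightarrow>\<^sub>L 'a"
  shows "(\<lambda>n. (t ^ n / fact n) *\<^sub>R ((o\<^sub>L) A ^^ n) id_blinfun) sums blinfun_exp (t *\<^sub>R A)"
  using summable_sums[OF summable_blinfun_exp[of "t *\<^sub>R A"]]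
  by (simp add: blinfun_exp_def blinfun_power_scaleR divide_inverse mult.commute)

lemma blinfun_exp_0: "blinfun_exp (0 :: 'a::banach \<Rightarrow>\<^sub>L 'a) = id_blinfun"
proof -
  have "((o\<^sub>L) 0 ^^ n) id_blinfun /\<^sub>R fact n = (if n = 0 then id_blinfun else (0 :: 'a \<Rightarrow>\<^sub>L 'a))" for n
    by (cases n) (simp_all add: blinfun_eqI)
  then show ?thesis
    using sums_unique[OF sums_single[of 0 "\<lambda>_. id_blinfun :: 'a \<Rightarrow>\<^sub>L 'a"]]
    by (simp add: blinfun_exp_def)
qed

text \<open>An operator commutes with its powers. Having \<open>A\<close> as the right factor gives
  the derivative of the exponential the form \<open>blinfun_exp (t *\<^sub>R A) o\<^sub>L A\<close>,
  which cancels directly in the variation of constants formula.\<close>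

lemma blinfun_power_Suc_right:
  fixes A :: "'a::banach \<Rightarrow>\<^sub>L 'a"
  shows "((o\<^sub>L) A ^^ Suc n) id_blinfun = ((o\<^sub>L) A ^^ n) id_blinfun o\<^sub>L A"
proof (induction n)
  case (Suc n)
  have "((o\<^sub>L) A ^^ Suc (Suc n)) id_blinfun = A o\<^sub>L (((o\<^sub>L) A ^^ n) id_blinfun o\<^sub>L A)"
    using Suc.IH by simp
  also have "\<dots> = ((o\<^sub>L) A ^^ Suc n) id_blinfun o\<^sub>L A"
    by (rule blinfun_eqI) simp
  finally show ?case .
qed (simp add: blinfun_eqI)

text \<open>Term-by-term differentiation: by the Weierstrass M-test the differentiated series
  converges uniformly on a ball around 0 that contains \<open>t\<close>.\<close>

lemma blinfun_exp_has_vector_derivative: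
  fixes A :: "'a::banach \<Rightarrow>\<^sub>L 'a"
  shows "((\<lambda>t. blinfun_exp (t *\<^sub>R A)) has_vector_derivative blinfun_exp (t *\<^sub>R A) o\<^sub>L A) (at t within T)"
proof -
  define P where "P = (\<lambda>n. ((o\<^sub>L) A ^^ n) id_blinfun)"
  define f where "f = (\<lambda>n t. (t ^ n / fact n) *\<^sub>R P n)"
  \<comment> \<open>These are the differentiated terms. For \<open>n = 0\<close> the truncated
    exponent is harmless because the factor \<open>real n\<close> vanishes, so \<open>g\<close> is
    the series of \<open>f\<close> shifted by one and composed with \<open>A\<close>.\<close>
  define g where "g = (\<lambda>n t. (real n * t ^ (n - 1) / fact n) *\<^sub>R P n)"
  define r where "r = \<bar>t\<bar> + 1"
  define S where "S = ball (0::real) r"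
  have P_Suc: "P (Suc n) = P n o\<^sub>L A" for n
    unfolding P_def by (rule blinfun_power_Suc_right)
  have g_Suc: "g (Suc n) s = f n s o\<^sub>L A" for n s
    by (simp add: g_def f_def P_Suc blinfun_eqI blinfun.bilinear_simps field_simps del: of_nat_Suc)
  have f_sums: "(\<lambda>n. f n s) sums blinfun_exp (s *\<^sub>R A)" for s
    unfolding f_def P_def by (rule blinfun_exp_scaleR_sums)
  have g_sums: "(\<lambda>n. g n s) sums (blinfun_exp (s *\<^sub>R A) o\<^sub>L A)" for s
  proof -
    have "(\<lambda>n. g (Suc n) s) sums (blinfun_exp (s *\<^sub>R A) o\<^sub>L A)"
      unfolding g_Suc
      by (rule bounded_linear.sums[OF bounded_bilinear.bounded_linear_left[OF bounded_bilinear_blinfun_compose] f_sums])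
    then show ?thesis
      using sums_Suc[of "\<lambda>n. g n s"] by (simp add: g_def)
  qed
  have le: "norm (g n s) \<le> real n * r ^ (n - 1) / fact n * norm A ^ n" if "s \<in> S" for n s
  proof -
    have "\<bar>s\<bar> \<le> r" using that by (simp add: S_def)
    then have "\<bar>real n * s ^ (n - 1) / fact n\<bar> \<le> real n * r ^ (n - 1) / fact n"
      by (auto simp: abs_mult power_abs intro!: divide_right_mono mult_left_mono power_mono)
    then show ?thesis
      unfolding g_def P_def norm_scaleR using norm_blinfun_power_le[of n A]
      by (rule mult_mono) (simp_all add: r_def)
  qed
  have "summable (\<lambda>n. real n * r ^ (n - 1) / fact n * norm A ^ n)"
  proof (subst summable_Suc_iff[symmetric])
    have "summable (\<lambda>n. norm A * ((r * norm A) ^ n /\<^sub>R fact n))"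
      by (intro summable_mult summable_exp_generic)
    then show "summable (\<lambda>n. real (Suc n) * r ^ (Suc n - 1) / fact (Suc n) * norm A ^ Suc n)"
      by (rule summable_cong[THEN iffD1, rotated])
        (simp add: field_simps power_mult_distrib del: of_nat_Suc)
  qed
  then have "uniform_limit S (\<lambda>n s. \<Sum>i<n. g i s) (\<lambda>s. \<Sum>i. g i s) sequentially"
    using le by (intro Weierstrass_m_test)
  then have lim: "uniform_limit S (\<lambda>n s. \<Sum>i<n. g i s) (\<lambda>s. blinfun_exp (s *\<^sub>R A) o\<^sub>L A) sequentially"
    using g_sums by (simp add: sums_iff)
  have "\<exists>G. \<forall>s\<in>S. (\<lambda>n. f n s) sums G s \<and>
      (G has_derivative (\<lambda>h. h *\<^sub>R (blinfun_exp (s *\<^sub>R A) o\<^sub>L A))) (at s within S)"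
  proof (rule has_derivative_series)
    show "convex S" "t \<in> S" by (simp_all add: S_def r_def)
    show "(\<lambda>n. f n t) sums blinfun_exp (t *\<^sub>R A)" by (rule f_sums)
    show "(f n has_derivative (\<lambda>h. h *\<^sub>R g n s)) (at s within S)" for n s
    proof -
      have "((\<lambda>s. s ^ n / fact n) has_real_derivative real n * s ^ (n - 1) / fact n) (at s within S)"
        by (auto intro!: derivative_eq_intros)
      then show ?thesis
        unfolding f_def g_def has_field_derivative_def
        by (auto intro!: derivative_eq_intros simp: mult.commute)
    qed
    show "\<forall>\<^sub>F n in sequentially. \<forall>s\<in>S. \<forall>h. norm ((\<Sum>i<n. h *\<^sub>R g i s) - h *\<^sub>R (blinfun_exp (s *\<^sub>R A) o\<^sub>L A))
        \<le> e * norm h" if "e > 0" for e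
      using uniform_limitD[OF lim that]
    proof eventually_elim
      case (elim n)
      show ?case
      proof (intro ballI allI)
        fix s h assume "s \<in> S"
        then have "norm ((\<Sum>i<n. g i s) - (blinfun_exp (s *\<^sub>R A) o\<^sub>L A)) \<le> e"
          using elim by (auto simp: dist_norm less_imp_le)
        then have "\<bar>h\<bar> * norm ((\<Sum>i<n. g i s) - (blinfun_exp (s *\<^sub>R A) o\<^sub>L A)) \<le> \<bar>h\<bar> * e"
          by (intro mult_left_mono) auto
        then show "norm ((\<Sum>i<n. h *\<^sub>R g i s) - h *\<^sub>R (blinfun_exp (s *\<^sub>R A) o\<^sub>L A)) \<le> e * norm h"
          by (simp flip: scaleR_sum_right scaleR_diff_right add: mult.commute)
      qed
    qed
  qed
  then obtain G where G: "\<And>s. s \<in> S \<Longrightarrow> (\<lambda>n. f n s) sums G s"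
      "\<And>s. s \<in> S \<Longrightarrow> (G has_vector_derivative (blinfun_exp (s *\<^sub>R A) o\<^sub>L A)) (at s within S)"
    unfolding has_vector_derivative_def by blast
  \<comment> \<open>\<open>G\<close> is a limit of the same series as the exponential, so the two
    agree on the open set \<open>S\<close> and the derivative carries over.\<close>
  have "t \<in> S" "open S" by (simp_all add: S_def r_def)
  then have "(G has_vector_derivative (blinfun_exp (t *\<^sub>R A) o\<^sub>L A)) (at t)"
    using G(2) at_within_open by metis
  then have "((\<lambda>t. blinfun_exp (t *\<^sub>R A)) has_vector_derivative blinfun_exp (t *\<^sub>R A) o\<^sub>L A) (at t)"
    by (rule has_vector_derivative_transform_within_open[OF _ \<open>open S\<close> \<open>t \<in> S\<close>])
      (metis G(1) f_sums sums_unique2)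
  then show ?thesis
    by (rule has_vector_derivative_at_within)
qed

text \<open>In the product rule for \<open>blinfun_exp ((t - s) *\<^sub>R A) (u s)\<close> the two
  terms containing \<open>A\<close> cancel and only \<open>g\<close> is left. Integrability comes
  with the fundamental theorem of calculus for the Henstock-Kurzweil integral.\<close>

lemma variation_of_constants:
  fixes A :: "'a::banach \<Rightarrow>\<^sub>L 'a"
  assumes u: "\<And>s. s \<in> {0..t} \<Longrightarrow> (u has_vector_derivative A (u s) + g s) (at s within {0..t})"
    and t: "0 \<le> t"
  shows "((\<lambda>s. blinfun_exp ((t - s) *\<^sub>R A) (g s)) has_integral u t - blinfun_exp (t *\<^sub>R A) (u 0)) {0..t}"
proof -
  let ?E = "\<lambda>s. blinfun_exp ((t - s) *\<^sub>R A)"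
  have "((\<lambda>s. ?E s (u s)) has_vector_derivative ?E s (g s)) (at s within {0..t})" if s: "s \<in> {0..t}" for s
  proof -
    have "((\<lambda>s. t - s) has_vector_derivative - 1) (at s within {0..t})"
      by (auto intro!: derivative_eq_intros)
    then have "(((\<lambda>r. blinfun_exp (r *\<^sub>R A)) \<circ> (\<lambda>s. t - s)) has_vector_derivative - 1 *\<^sub>R (?E s o\<^sub>L A))
        (at s within {0..t})"
      by (rule vector_diff_chain_within) (rule blinfun_exp_has_vector_derivative)
    from bounded_bilinear.has_vector_derivative[OF bounded_bilinear_blinfun_apply this u[OF s]]
    show ?thesis
      by (simp add: o_def blinfun.bilinear_simps)
  qed
  from fundamental_theorem_of_calculus[OF t this] show ?thesis
    by (simp add: blinfun_exp_0)
qed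

section \<open>The graphon equation\<close>

text \<open>Elements of the ball have representatives with values in \<open>{- R..R}\<close> almost
  everywhere, so the Lipschitz constant of \<open>\<Phi>\<close> on that interval passes to the
  essential supremum.\<close>

lemma superposition_lipschitz:
  assumes "locally_lipschitz \<Phi>"
  shows "\<exists>L. L-lipschitz_on (cball 0 R) (superposition \<Phi>)"
proof -
  obtain L where L: "L-lipschitz_on {- R..R} \<Phi>"
    using assms bounded_closed_interval unfolding locally_lipschitz_def by blast
  have "L-lipschitz_on (cball 0 R) (superposition \<Phi>)"
  proof (rule lipschitz_onI)
    show "0 \<le> L" by (rule lipschitz_on_nonneg[OF L])
    fix u v :: Linf assume "u \<in> cball 0 R" "v \<in> cball 0 R"
    then have R: "norm u \<le> R" "norm v \<le> R" by simp_all
    let ?f = "\<lambda>x. \<Phi> (rep_Linf u x)" and ?g = "\<lambda>x. \<Phi> (rep_Linf v x)"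
    have fg: "?f \<in> ess_bounded" "?g \<in> ess_bounded"
      by (simp_all add: superposition_to_Linf[OF assms])
    have "AE x in unit_interval. \<bar>?f x - ?g x\<bar> \<le> L * norm (u - v)"
      using AE_Linf_norm(1)[OF rep_Linf_ess_bounded[of u]] AE_Linf_norm(1)[OF rep_Linf_ess_bounded[of v]]
        AE_abs_diff_le_norm[of u v]
    proof eventually_elim
      case (elim x)
      have "\<bar>?f x - ?g x\<bar> \<le> L * \<bar>rep_Linf u x - rep_Linf v x\<bar>"
        using lipschitz_onD[OF L, of "rep_Linf u x" "rep_Linf v x"] elim R
        by (auto simp: dist_real_def norm_Linf_eq abs_le_iff)
      also have "\<dots> \<le> L * norm (u - v)"
        using elim(3) \<open>0 \<le> L\<close> by (rule mult_left_mono)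
      finally show ?case .
    qed
    then have "Linf_norm (\<lambda>x. ?f x - ?g x) \<le> L * norm (u - v)"
      by (rule AE_Linf_norm(3)[OF ess_bounded_diff[OF fg]])
    then show "dist (superposition \<Phi> u) (superposition \<Phi> v) \<le> L * dist u v"
      by (simp add: dist_norm superposition_def norm_to_Linf ess_bounded_diff fg flip: to_Linf_diff)
  qed
  then show ?thesis by blast
qed

theorem theorem3p7:
  fixes W :: "real \<Rightarrow> real \<Rightarrow> real" and \<Phi> :: "real \<Rightarrow> real" and u\<^sub>0 :: Linf and M :: real
  assumes "admissible_graphon W"
    and "\<Phi> 0 = 0" and "locally_lipschitz \<Phi>"
    and "M > 0" and "norm u\<^sub>0 \<le> M"
  shows "\<exists>Tmax :: ereal. 0 < Tmax \<and>
    (let I = {t. 0 \<le> t \<and> ereal t < Tmax} in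
      \<exists>u. classical_solution W \<Phi> u\<^sub>0 I u \<and>
        (\<forall>v. classical_solution W \<Phi> u\<^sub>0 I v \<longrightarrow> (\<forall>t\<in>I. v t = u t)) \<and>
        mild_formulation W \<Phi> u\<^sub>0 I u \<and>
        (Tmax < \<infinity> \<longrightarrow> filterlim (\<lambda>t. norm (u t)) at_top (at_left (real_of_ereal Tmax))))"
proof -
  define F where "F = (\<lambda>u. graphon_operator W u + superposition \<Phi> u)"
  have lip: "\<exists>L. L-lipschitz_on (cball 0 R) F" for R
  proof -
    obtain L where "L-lipschitz_on (cball 0 R) (superposition \<Phi>)"
      using superposition_lipschitz[OF assms(3)] by blast
    moreover have "(norm (graphon_operator W))-lipschitz_on (cball 0 R) (graphon_operator W)"
      using norm_blinfun[of "graphon_operator W"]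
      by (intro lipschitz_onI) (simp_all add: dist_norm flip: blinfun.diff_right)
    ultimately have "(norm (graphon_operator W) + L)-lipschitz_on (cball 0 R) F"
      unfolding F_def by (intro lipschitz_on_add)
    then show ?thesis by blast
  qed
  \<comment> \<open>Continuity of \<open>F\<close> makes \<open>F (u t)\<close> continuous in
    \<open>t\<close>, so the \<open>C1_on\<close> requirement follows from the equation
    itself.\<close>
  have F_cont: "continuous_on UNIV F"
  proof (rule continuous_at_imp_continuous_on, rule ballI)
    fix y :: Linf
    obtain L where "L-lipschitz_on (cball 0 (norm y + 1)) F" using lip by blast
    then have "continuous_on (ball 0 (norm y + 1)) F"
      by (meson ball_subset_cball continuous_on_subset lipschitz_on_continuous_on)
    then show "isCont F y" by (simp add: continuous_on_eq_continuous_at)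
  qed
  have classical_iff: "classical_solution W \<Phi> u\<^sub>0 I u \<longleftrightarrow> u 0 = u\<^sub>0 \<and> ode_solution F I u" for I u
  proof -
    have "C1_on I u" if "ode_solution F I u"
      unfolding C1_on_def using that ode_solution_continuous[OF that]
      by (intro exI[of _ "\<lambda>t. F (u t)"])
        (auto simp: ode_solution_def intro: continuous_on_compose2[OF F_cont])
    then show ?thesis
      by (auto simp: classical_solution_def ode_solution_def F_def)
  qed
  obtain Tmax u where Tmax: "0 < Tmax" and u0: "u 0 = u\<^sub>0"
    and u: "ode_solution F {t. 0 \<le> t \<and> ereal t < Tmax} u"
    and blowup: "Tmax < \<infinity> \<Longrightarrow> filterlim (\<lambda>t. norm (u t)) at_top (at_left (real_of_ereal Tmax))"
    using ode_solution_maximal[OF lip, of u\<^sub>0] by blast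
  define I where "I = {t. 0 \<le> t \<and> ereal t < Tmax}"
  \<comment> \<open>Uniqueness and variation of constants are stated on compact intervals; each time
    in \<open>I\<close> is reached through such an interval inside \<open>I\<close>.\<close>
  have sub: "{0..t} \<subseteq> I" if "t \<in> I" for t
    using that unfolding I_def by (auto intro: le_less_trans[of "ereal _" "ereal t"])
  have "\<forall>t\<in>I. v t = u t" if v: "classical_solution W \<Phi> u\<^sub>0 I v" for v
  proof
    fix t assume t: "t \<in> I"
    have "ode_solution F {0..t} v" "ode_solution F {0..t} u" "v 0 = u 0" "t \<in> {0..t}"
      using v u u0 t ode_solution_subset[OF _ sub[OF t]] by (auto simp: classical_iff I_def)
    then show "v t = u t"
      by (rule ode_solution_unique[OF lip])
  qed
  moreover have "mild_formulation W \<Phi> u\<^sub>0 I u"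
    unfolding mild_formulation_def
  proof
    fix t assume t: "t \<in> I"
    have "ode_solution F {0..t} u"
      using u ode_solution_subset[OF _ sub[OF t]] by (simp add: I_def)
    then have "((\<lambda>s. graphon_semigroup W (t - s) (superposition \<Phi> (u s))) has_integral
        u t - graphon_semigroup W t u\<^sub>0) {0..t}"
      using t unfolding graphon_semigroup_def u0[symmetric]
      by (intro variation_of_constants) (auto simp: ode_solution_def F_def I_def)
    then show "(\<lambda>s. graphon_semigroup W (t - s) (superposition \<Phi> (u s))) integrable_on {0..t} \<and>
        u t = graphon_semigroup W t u\<^sub>0
          + integral {0..t} (\<lambda>s. graphon_semigroup W (t - s) (superposition \<Phi> (u s)))"
      by (auto simp: has_integral_iff)
  qed
  moreover have "classical_solution W \<Phi> u\<^sub>0 I u"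
    using u u0 by (simp add: classical_iff I_def)
  ultimately show ?thesis
    using Tmax blowup by (auto simp: Let_def I_def)
qed

end
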